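(* Every bridgeless cubic finite graph $G$ admits a strong $\mathbb{Q}$-emm.
   Context: Cubic means every vertex has degree 3 (loops and multiple edges allowed). For a finite graph $G$ with oriented edges $e_i$, $H_1(G,\mathbb{Z})$ is its cycle group, $H^1(G,\mathbb{Z})$ its dual (cokernel of the coboundary $C^0\to\bigoplus\mathbb{Z}e_i^*$), and the image of $e_i^*$ in $H^1$ is the coedge $e_i^*$. A $\mathbb{Q}$-emm is $q\in\mathrm{Sym}^2H_1(G,\mathbb{Q})$, viewed as a quadratic form on $H^1(G,\mathbb{R})$, that is positive definite, satisfies $q(e_i^* )=1$ for every edge $e_i$ that is not a bridge, and $q(v)\ge1$ for all nonzero $v\in H^1(G,\mathbb{Z})$. It is strong if moreover $q(v)=1$ for $v\in H^1(G,\mathbb{Z})$ implies that $\pm v$ is a coedge. *)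

theory Defs
  imports "HOL-Analysis.Analysis" "Graph_Theory.Digraph"
begin

text \<open>A finite graph (loops and multiple edges allowed) is represented by a
  finite digraph G (Graph_Theory's pre_digraph with fin_digraph); the direction of
  each arc is the chosen orientation of the edge. Edges = arcs G.\<close>

definition degree :: "('v,'e) pre_digraph \<Rightarrow> 'v \<Rightarrow> nat" where
  "degree G v = in_degree G v + out_degree G v"   \<comment> \<open>a loop counts twice\<close>

definition cubic :: "('v,'e) pre_digraph \<Rightarrow> bool" where
  "cubic G \<longleftrightarrow> (\<forall>v\<in>verts G. degree G v = 3)"

definition undir_adj :: "('v,'e) pre_digraph \<Rightarrow> ('v \<times> 'v) set" where
  "undir_adj G = {(u,w). \<exists>a\<in>arcs G. (tail G a = u \<and> head G a = w) \<or> (tail G a = w \<and> head G a = u)}"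

definition is_bridge :: "('v,'e) pre_digraph \<Rightarrow> 'e \<Rightarrow> bool" where
  "is_bridge G e \<longleftrightarrow> e \<in> arcs G \<and>
     (tail G e, head G e) \<notin> (undir_adj (pre_digraph.del_arc G e))\<^sup>*"

definition bridgeless :: "('v,'e) pre_digraph \<Rightarrow> bool" where
  "bridgeless G \<longleftrightarrow> (\<forall>e\<in>arcs G. \<not> is_bridge G e)"

definition real_coboundary :: "('v,'e) pre_digraph \<Rightarrow> ('e \<Rightarrow> real) \<Rightarrow> bool" where
  "real_coboundary G x \<longleftrightarrow> (\<exists>f::'v \<Rightarrow> real. \<forall>e\<in>arcs G. x e = f (head G e) - f (tail G e))"

definition int_coboundary :: "('v,'e) pre_digraph \<Rightarrow> ('e \<Rightarrow> int) \<Rightarrow> bool" where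
  "int_coboundary G x \<longleftrightarrow> (\<exists>f::'v \<Rightarrow> int. \<forall>e\<in>arcs G. x e = f (head G e) - f (tail G e))"

definition H1_int_eq :: "('v,'e) pre_digraph \<Rightarrow> ('e \<Rightarrow> int) \<Rightarrow> ('e \<Rightarrow> int) \<Rightarrow> bool" where
  "H1_int_eq G x y \<longleftrightarrow> int_coboundary G (\<lambda>e. x e - y e)"

definition coedge :: "'e \<Rightarrow> ('e \<Rightarrow> int)" where
  "coedge a = (\<lambda>e. if e = a then 1 else 0)"

definition is_cycle_rat :: "('v,'e) pre_digraph \<Rightarrow> ('e \<Rightarrow> rat) \<Rightarrow> bool" where
  "is_cycle_rat G c \<longleftrightarrow> (\<forall>v\<in>verts G.
     (\<Sum>e\<in>{e\<in>arcs G. head G e = v}. c e) - (\<Sum>e\<in>{e\<in>arcs G. tail G e = v}. c e) = 0)"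

text \<open>Elements of Sym^2 H_1(G,Q), viewed inside Sym^2 Q^E as symmetric
  arcs-by-arcs rational matrices whose columns are cycles (zero outside arcs).\<close>
definition in_Sym2_H1 :: "('v,'e) pre_digraph \<Rightarrow> ('e \<Rightarrow> 'e \<Rightarrow> rat) \<Rightarrow> bool" where
  "in_Sym2_H1 G M \<longleftrightarrow>
     (\<forall>e e'. M e e' = M e' e) \<and>
     (\<forall>e e'. e \<notin> arcs G \<or> e' \<notin> arcs G \<longrightarrow> M e e' = 0) \<and>
     (\<forall>e'\<in>arcs G. is_cycle_rat G (\<lambda>e. M e e'))"

text \<open>The associated quadratic form evaluated on a real cochain (well defined on H^1).\<close>
definition qform :: "('v,'e) pre_digraph \<Rightarrow> ('e \<Rightarrow> 'e \<Rightarrow> rat) \<Rightarrow> ('e \<Rightarrow> real) \<Rightarrow> real" where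
  "qform G M x = (\<Sum>e\<in>arcs G. \<Sum>e'\<in>arcs G. real_of_rat (M e e') * x e * x e')"

definition is_Q_emm :: "('v,'e) pre_digraph \<Rightarrow> ('e \<Rightarrow> 'e \<Rightarrow> rat) \<Rightarrow> bool" where
  "is_Q_emm G M \<longleftrightarrow>
     in_Sym2_H1 G M \<and>
     \<comment> \<open>positive definite on H^1(G,R)\<close>
     (\<forall>x::'e \<Rightarrow> real. \<not> real_coboundary G x \<longrightarrow> qform G M x > 0) \<and>
     \<comment> \<open>q(e^*) = 1 for non-bridges\<close>
     (\<forall>a\<in>arcs G. \<not> is_bridge G a \<longrightarrow> qform G M (\<lambda>e. real_of_int (coedge a e)) = 1) \<and>
     \<comment> \<open>q(v) \<ge> 1 for nonzero v in H^1(G,Z)\<close>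
     (\<forall>x::'e \<Rightarrow> int. \<not> int_coboundary G x \<longrightarrow> qform G M (\<lambda>e. real_of_int (x e)) \<ge> 1)"

definition is_strong_Q_emm :: "('v,'e) pre_digraph \<Rightarrow> ('e \<Rightarrow> 'e \<Rightarrow> rat) \<Rightarrow> bool" where
  "is_strong_Q_emm G M \<longleftrightarrow> is_Q_emm G M \<and>
     (\<forall>x::'e \<Rightarrow> int. qform G M (\<lambda>e. real_of_int (x e)) = 1 \<longrightarrow>
        (\<exists>a\<in>arcs G. H1_int_eq G x (coedge a) \<or> H1_int_eq G x (\<lambda>e. - coedge a e)))"

end

theory Submission
  imports Defs
begin

text \<open>For an even subgraph $D$ (an element of $H_1(G, \mathbf F_2)$), average $w(c)^2$ over all
  Eulerian orientations $c$ of $D$, viewed as cycles with values $\pm 1$ on $D$. The form $q(w)$ is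
  the sum of these averages over all $D$, multiplied by $2 / |H_1(G, \mathbf F_2)|$.
  If $w$ is nonzero modulo 2, then $w(c)$ is odd for exactly half of the $D$, so $q(w) \ge 1$; an
  arc that is not a bridge lies in half of the $D$, so its coedge has $q = 1$. A class
  divisible by 2 is handled by descent. If $q(w) = 1$, then $|w(c)| \le 1$ for every cycle $c$ with
  values in $\{-1, 0, 1\}$, and circulation duality provides a representative of $w$ of
  $\ell^1$-norm at most 1, that is, plus or minus a coedge.\<close>

section \<open>Boundaries, integral cycles and their pairing with cochains\<close>

definition bd :: "('v,'e) pre_digraph \<Rightarrow> ('e \<Rightarrow> int) \<Rightarrow> 'v \<Rightarrow> int" where
  "bd G c v = (\<Sum>e\<in>arcs G. c e * (of_bool (head G e = v) - of_bool (tail G e = v)))"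

definition int_cycle :: "('v,'e) pre_digraph \<Rightarrow> ('e \<Rightarrow> int) \<Rightarrow> bool" where
  "int_cycle G c \<longleftrightarrow> (\<forall>v. bd G c v = 0)"

text \<open>The coefficients lie in an arbitrary commutative ring so that the same lemmas serve
  integral and real cochains. Only values on arcs enter, here and in \<open>bd\<close>.\<close>

definition pairing :: "('v,'e) pre_digraph \<Rightarrow> ('e \<Rightarrow> int) \<Rightarrow> ('e \<Rightarrow> 'a) \<Rightarrow> 'a::comm_ring_1" where
  "pairing G c x = (\<Sum>e\<in>arcs G. of_int (c e) * x e)"

lemma bd_add: "bd G (\<lambda>e. c e + d e) v = bd G c v + bd G d v"
  by (simp add: bd_def algebra_simps sum.distrib sum_subtractf)

lemma bd_diff: "bd G (\<lambda>e. c e - d e) v = bd G c v - bd G d v"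
  by (simp add: bd_def algebra_simps sum.distrib sum_subtractf)

lemma bd_scale: "bd G (\<lambda>e. k * c e) v = k * bd G c v"
  by (simp add: bd_def sum_distrib_left mult.assoc)

lemma int_cycle_add: "int_cycle G c \<Longrightarrow> int_cycle G d \<Longrightarrow> int_cycle G (\<lambda>e. c e + d e)"
  by (simp add: int_cycle_def bd_add)

lemma pairing_add: "pairing G (\<lambda>e. c e + d e) x = pairing G c x + pairing G d x"
  by (simp add: pairing_def algebra_simps sum.distrib)

lemma pairing_diff: "pairing G (\<lambda>e. c e - d e) x = pairing G c x - pairing G d x"
  by (simp add: pairing_def algebra_simps sum_subtractf)

lemma pairing_add_right: "pairing G c (\<lambda>e. x e + y e) = pairing G c x + pairing G c y"
  by (simp add: pairing_def algebra_simps sum.distrib)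

lemma pairing_scale_right: "pairing G c (\<lambda>e. k * x e) = k * pairing G c x"
  by (simp add: pairing_def sum_distrib_left mult.left_commute)

lemma pairing_of_int: "pairing G c (\<lambda>e. of_int (x e)) = of_int (pairing G c x)"
  by (simp add: pairing_def)

context fin_digraph
begin

lemma bd_single:
  assumes "a \<in> arcs G"
  shows "bd G (\<lambda>e. k * of_bool (e = a)) v = k * (of_bool (head G a = v) - of_bool (tail G a = v))"
proof -
  have "bd G (\<lambda>e. k * of_bool (e = a)) v
      = (\<Sum>e\<in>arcs G. if a = e then k * (of_bool (head G a = v) - of_bool (tail G a = v)) else 0)"
    unfolding bd_def by (rule sum.cong) auto
  then show ?thesis using assms by simp
qed

lemma pairing_single:
  assumes "a \<in> arcs G"
  shows "pairing G (\<lambda>e. of_bool (e = a)) x = x a"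
proof -
  have "pairing G (\<lambda>e. of_bool (e = a)) x = (\<Sum>e\<in>arcs G. if a = e then x a else 0)"
    unfolding pairing_def by (rule sum.cong) auto
  then show ?thesis using assms by simp
qed

lemma pairing_coedge:
  assumes "a \<in> arcs G"
  shows "pairing G c (coedge a) = c a"
proof -
  have "pairing G c (coedge a) = (\<Sum>e\<in>arcs G. if a = e then c a else 0)"
    unfolding pairing_def coedge_def by (rule sum.cong) auto
  then show ?thesis using assms by simp
qed

text \<open>The coboundary is the adjoint of the boundary: write the value of \<open>f\<close> at
  each endpoint as a sum of indicators over the vertices and exchange the sums.\<close>

lemma bd_adjoint:
  fixes f :: "'a \<Rightarrow> 'r::comm_ring_1"
  shows "pairing G c (\<lambda>e. f (head G e) - f (tail G e)) = (\<Sum>v\<in>verts G. f v * of_int (bd G c v))"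
proof -
  have *: "of_int (c e) * (f (head G e) - f (tail G e))
     = (\<Sum>v\<in>verts G. f v * (of_int (c e) * (of_bool (head G e = v) - of_bool (tail G e = v))))"
    if "e \<in> arcs G" for e
  proof -
    have "(\<Sum>v\<in>verts G. f v * (of_int (c e) * (of_bool (head G e = v) - of_bool (tail G e = v))))
      = of_int (c e) * ((\<Sum>v\<in>verts G. if head G e = v then f v else 0) - (\<Sum>v\<in>verts G. if tail G e = v then f v else 0))"
      unfolding sum_subtractf[symmetric] sum_distrib_left
      by (rule sum.cong) (auto simp: algebra_simps)
    then show ?thesis using that finite_verts by simp
  qed
  have "pairing G c (\<lambda>e. f (head G e) - f (tail G e))
     = (\<Sum>e\<in>arcs G. \<Sum>v\<in>verts G. f v * (of_int (c e) * (of_bool (head G e = v) - of_bool (tail G e = v))))"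
    unfolding pairing_def by (rule sum.cong) (simp_all add: *)
  also have "\<dots> = (\<Sum>v\<in>verts G. f v * of_int (bd G c v))"
    unfolding bd_def by (subst sum.swap) (simp add: sum_distrib_left)
  finally show ?thesis .
qed

lemma pairing_coboundary:
  fixes f :: "'a \<Rightarrow> 'r::comm_ring_1"
  assumes "int_cycle G c"
  shows "pairing G c (\<lambda>e. f (head G e) - f (tail G e)) = 0"
  using assms by (simp add: bd_adjoint int_cycle_def)

lemma bd_outside: "v \<notin> verts G \<Longrightarrow> bd G c v = 0"
  unfolding bd_def by (rule sum.neutral) auto

lemma sum_bd: "(\<Sum>v\<in>verts G. bd G c v) = 0"
  using bd_adjoint[of c "\<lambda>_. 1::int"] by (simp add: pairing_def)

section \<open>Integral circulations within bounds\<close>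

lemma augment_along_residual:
  fixes l u c :: "'b \<Rightarrow> int"
  assumes bounds: "\<forall>e\<in>arcs G. l e \<le> c e \<and> c e \<le> u e"
  defines "R \<equiv> {(a, b). \<exists>e\<in>arcs G. (tail G e = a \<and> head G e = b \<and> c e < u e) \<or>
                                    (head G e = a \<and> tail G e = b \<and> l e < c e)}"
  assumes "(s, t) \<in> R\<^sup>*"
  shows "\<exists>c'. (\<forall>e\<in>arcs G. l e \<le> c' e \<and> c' e \<le> u e) \<and>
              (\<forall>v. bd G c' v = bd G c v + of_bool (v = t) - of_bool (v = s))"
proof -
  \<comment> \<open>\<open>W n\<close> is the set of vertices reachable from \<open>s\<close> in at
    most \<open>n\<close> residual steps.\<close>
  define W where "W = rec_nat {s} (\<lambda>_ X. X \<union> R `` X)"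
  have W0: "W 0 = {s}" and WS: "W (Suc n) = W n \<union> R `` W n" for n
    by (simp_all add: W_def)
  have "\<exists>n. t \<in> W n" using assms(3)
  proof (induction rule: rtrancl_induct)
    case base then show ?case using W0 by blast
  next
    case (step y z) then show ?case using WS by blast
  qed
  then obtain n where "t \<in> W n" by blast
  \<comment> \<open>Breadth-first layers: the changes made so far stay inside the current layer set, so the
     arc leading to a new vertex still has its full residual capacity.\<close>
  then have "\<exists>c'. (\<forall>e\<in>arcs G. l e \<le> c' e \<and> c' e \<le> u e) \<and>
              (\<forall>v. bd G c' v = bd G c v + of_bool (v = t) - of_bool (v = s)) \<and>
              (\<forall>e. c' e \<noteq> c e \<longrightarrow> head G e \<in> W n \<and> tail G e \<in> W n)"
  proof (induction n arbitrary: t)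
    case 0
    then show ?case using bounds by (intro exI[of _ c]) (auto simp: W0)
  next
    case (Suc n)
    show ?case
    proof (cases "t \<in> W n")
      case True
      then show ?thesis using Suc.IH[OF True] WS by blast
    next
      case False
      then obtain a where a: "a \<in> W n" "(a, t) \<in> R" using Suc.prems WS by blast
      obtain c' where c': "\<forall>e\<in>arcs G. l e \<le> c' e \<and> c' e \<le> u e"
        "\<And>v. bd G c' v = bd G c v + of_bool (v = a) - of_bool (v = s)"
        "\<And>e. c' e \<noteq> c e \<Longrightarrow> head G e \<in> W n \<and> tail G e \<in> W n"
        using Suc.IH[OF a(1)] by blast
      obtain e k where e: "e \<in> arcs G" and k: "l e \<le> c e + k" "c e + k \<le> u e"
        and ends: "tail G e = a \<and> head G e = t \<and> k = 1 \<or> head G e = a \<and> tail G e = t \<and> k = -1"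
        using a(2) bounds unfolding R_def by force
      have ce: "c' e = c e" using c'(3)[of e] False ends by blast
      define c'' where "c'' = (\<lambda>x. c' x + k * of_bool (x = e))"
      have "bd G c'' v = bd G c v + of_bool (v = t) - of_bool (v = s)" for v
        unfolding c''_def bd_add bd_single[OF e] c'(2) using ends by auto
      moreover have "\<forall>x\<in>arcs G. l x \<le> c'' x \<and> c'' x \<le> u x"
        using c'(1) k ce by (auto simp: c''_def)
      moreover have "head G x \<in> W (Suc n) \<and> tail G x \<in> W (Suc n)" if "c'' x \<noteq> c x" for x
      proof (cases "x = e")
        case True
        then show ?thesis using ends a(1) Suc.prems WS by auto
      next
        case False
        then show ?thesis using that c'(3)[of x] WS by (auto simp: c''_def)
      qed
      ultimately show ?thesis by blast
    qed
  qed
  then show ?thesis by blast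
qed

text \<open>Choose an assignment within the bounds whose total imbalance is least. If some vertex
  \<open>s\<close> has surplus inflow, no vertex residually reachable from \<open>s\<close> has a
  deficit, since augmenting would lower the imbalance. The arcs crossing the reachable set are then
  at their bounds, so its positive net inflow is exactly a cut sum, contrary to
  \<open>cut\<close>.\<close>

theorem hoffman_circulation:
  fixes l u :: "'b \<Rightarrow> int"
  assumes lu: "\<forall>e\<in>arcs G. l e \<le> u e"
    and cut: "\<And>U. (\<Sum>e\<in>arcs G. if head G e \<in> U \<and> tail G e \<notin> U then l e
                   else if tail G e \<in> U \<and> head G e \<notin> U then - u e else 0) \<le> 0"
  shows "\<exists>c. int_cycle G c \<and> (\<forall>e\<in>arcs G. l e \<le> c e \<and> c e \<le> u e)"
proof -
  define P where "P c \<longleftrightarrow> (\<forall>e\<in>arcs G. l e \<le> c e \<and> c e \<le> u e)" for c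
  define imb where "imb c = (\<Sum>v\<in>verts G. nat \<bar>bd G c v\<bar>)" for c
  \<comment> \<open>By \<open>lu\<close> the lower bound \<open>l\<close> is itself admissible, so a
    minimum exists.\<close>
  obtain c where c: "P c" and cmin: "\<And>c'. P c' \<Longrightarrow> imb c \<le> imb c'"
    using ex_has_least_nat[of P l imb] lu by (auto simp: P_def)
  have "int_cycle G c"
  proof (rule ccontr)
    assume "\<not> int_cycle G c"
    then obtain v where v: "v \<in> verts G" "bd G c v \<noteq> 0"
      using bd_outside unfolding int_cycle_def by blast
    have "\<exists>s\<in>verts G. bd G c s > 0"
    proof (rule ccontr)
      assume "\<not> ?thesis"
      then have "\<forall>s\<in>verts G. - bd G c s \<ge> 0" by auto
      moreover have "(\<Sum>s\<in>verts G. - bd G c s) = 0" by (simp add: sum_negf sum_bd)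
      ultimately have "\<forall>s\<in>verts G. - bd G c s = 0"
        using sum_nonneg_eq_0_iff[OF finite_verts, of "\<lambda>s. - bd G c s"] by blast
      then show False using v by auto
    qed
    then obtain s where s: "s \<in> verts G" "bd G c s > 0" by blast
    define R where "R = {(a, b). \<exists>e\<in>arcs G. (tail G e = a \<and> head G e = b \<and> c e < u e) \<or>
                                    (head G e = a \<and> tail G e = b \<and> l e < c e)}"
    define U where "U = R\<^sup>* `` {s}"
    have closed: "b \<in> U" if "a \<in> U" "(a, b) \<in> R" for a b
      using that unfolding U_def by (meson Image_singleton_iff rtrancl.rtrancl_into_rtrancl)
    have nonneg: "bd G c t \<ge> 0" if "t \<in> U" for t
    proof (rule ccontr)
      assume neg: "\<not> bd G c t \<ge> 0"
      have tv: "t \<in> verts G" using neg bd_outside[of t c] by auto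
      have "(s, t) \<in> R\<^sup>*" using that by (simp add: U_def)
      then obtain c' where c': "P c'" "\<And>v. bd G c' v = bd G c v + of_bool (v = t) - of_bool (v = s)"
        using augment_along_residual[of l c u s t] c unfolding P_def R_def by blast
      \<comment> \<open>Both \<bar>bd\<bar> at \<open>s\<close> and at \<open>t\<close> drop by one;
        all other vertices keep their value.\<close>
      have "imb c' < imb c" unfolding imb_def
        by (rule sum_strict_mono_ex1) (use finite_verts s neg c'(2) in auto)
      then show False using cmin[OF c'(1)] by simp
    qed
    have "0 < (\<Sum>v\<in>verts G. of_bool (v \<in> U) * bd G c v)"
      by (rule sum_pos2[of _ s]) (use finite_verts s nonneg in \<open>auto simp: U_def\<close>)
    also have "\<dots> = pairing G c (\<lambda>e. of_bool (head G e \<in> U) - of_bool (tail G e \<in> U))"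
      using bd_adjoint[of c "\<lambda>v. of_bool (v \<in> U) :: int"] by simp
    also have "\<dots> = (\<Sum>e\<in>arcs G. if head G e \<in> U \<and> tail G e \<notin> U then l e
                   else if tail G e \<in> U \<and> head G e \<notin> U then - u e else 0)"
      unfolding pairing_def
    proof (rule sum.cong)
      fix e assume e: "e \<in> arcs G"
      \<comment> \<open>An entering arc above its lower bound, or below a leaving arc below its
        upper bound, would be a residual step out of \<open>U\<close>.\<close>
      have "c e = l e" if "head G e \<in> U" "tail G e \<notin> U"
        using closed[OF that(1), of "tail G e"] that e c unfolding P_def R_def by force
      moreover have "c e = u e" if "tail G e \<in> U" "head G e \<notin> U"
        using closed[OF that(1), of "head G e"] that e c unfolding P_def R_def by force
      ultimately show "of_int (c e) * (of_bool (head G e \<in> U) - of_bool (tail G e \<in> U)) =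
        (if head G e \<in> U \<and> tail G e \<notin> U then l e
                   else if tail G e \<in> U \<and> head G e \<notin> U then - u e else 0)"
        by auto
    qed simp
    also have "\<dots> \<le> 0" by (rule cut)
    finally show False by simp
  qed
  then show ?thesis using c unfolding P_def by blast
qed

text \<open>The fractional circulation z/2 lies between its floor and its ceiling, so these bounds
  admit an integral circulation \<open>y\<close>. Then z - 2y has the parity of \<open>z\<close> and
  values in {-1, 0, 1}: it is an Eulerian orientation of the odd support of
  \<open>z\<close>.\<close>

lemma unit_cycle_of_parity:
  assumes z: "int_cycle G z"
  shows "\<exists>c. int_cycle G c \<and> (\<forall>e. c e = 0 \<or> c e = 1 \<or> c e = -1) \<and>
             (\<forall>e. odd (c e) \<longleftrightarrow> e \<in> arcs G \<and> odd (z e))"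
proof -
  let ?l = "\<lambda>e. z e div 2" and ?u = "\<lambda>e. (z e + 1) div 2"
  have "\<exists>y. int_cycle G y \<and> (\<forall>e\<in>arcs G. ?l e \<le> y e \<and> y e \<le> ?u e)"
  proof (rule hoffman_circulation)
    fix U
    \<comment> \<open>Termwise, as 2 * floor(z/2) \<le> z \<le> 2 * ceiling(z/2); the right side is
      the net inflow of the cycle \<open>z\<close> into \<open>U\<close>.\<close>
    have "2 * (\<Sum>e\<in>arcs G. if head G e \<in> U \<and> tail G e \<notin> U then ?l e
                   else if tail G e \<in> U \<and> head G e \<notin> U then - ?u e else 0)
       \<le> pairing G z (\<lambda>e. of_bool (head G e \<in> U) - of_bool (tail G e \<in> U))"
      unfolding pairing_def sum_distrib_left by (rule sum_mono) auto
    also have "\<dots> = 0" using pairing_coboundary[OF z, of "\<lambda>v. of_bool (v \<in> U)"] .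
    finally show "(\<Sum>e\<in>arcs G. if head G e \<in> U \<and> tail G e \<notin> U then ?l e
                   else if tail G e \<in> U \<and> head G e \<notin> U then - ?u e else 0) \<le> 0" by simp
  qed auto
  then obtain y where y: "int_cycle G y" "\<And>e. e \<in> arcs G \<Longrightarrow> ?l e \<le> y e \<and> y e \<le> ?u e" by blast
  define c where "c e = (if e \<in> arcs G then z e - 2 * y e else 0)" for e
  have "bd G c v = bd G (\<lambda>e. z e - 2 * y e) v" for v
    unfolding bd_def c_def by (rule sum.cong) auto
  then have "int_cycle G c" using z y(1) by (simp add: int_cycle_def bd_diff bd_scale)
  moreover have "c e = 0 \<or> c e = 1 \<or> c e = -1" for e
    using y(2)[of e] unfolding c_def by (cases "e \<in> arcs G") (simp; presburger)+
  moreover have "odd (c e) \<longleftrightarrow> e \<in> arcs G \<and> odd (z e)" for e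
    unfolding c_def by auto
  ultimately show ?thesis by blast
qed

text \<open>Let \<open>f\<close> minimise the l1 norm of w - df. Optimality under unit changes of
  \<open>f\<close> is the cut condition for circulations that equal the sign of w - df wherever it
  is nonzero; such a circulation attains the norm.\<close>

lemma unit_cycle_duality:
  fixes w :: "'b \<Rightarrow> int"
  shows "\<exists>c f. int_cycle G c \<and> (\<forall>e\<in>arcs G. c e = 0 \<or> c e = 1 \<or> c e = -1) \<and>
      pairing G c w = (\<Sum>e\<in>arcs G. \<bar>w e - (f (head G e) - f (tail G e))\<bar>)"
proof -
  define N where "N f = (\<Sum>e\<in>arcs G. \<bar>w e - (f (head G e) - f (tail G e))\<bar>)" for f :: "'a \<Rightarrow> int"
  have Nnn: "N f \<ge> 0" for f by (simp add: N_def sum_nonneg)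
  obtain f where "\<And>f'. nat (N f) \<le> nat (N f')"
    using ex_has_least_nat[of "\<lambda>_. True" undefined "\<lambda>f. nat (N f)"] by auto
  then have fmin: "N f \<le> N f'" for f' using Nnn[of f] Nnn[of f'] by (metis nat_le_eq_zle le_antisym linorder_le_cases)
  define x where "x e = w e - (f (head G e) - f (tail G e))" for e
  \<comment> \<open>These bounds force the sign of \<open>x e\<close> where \<open>x e\<close> is
    nonzero and leave [-1, 1] where it vanishes.\<close>
  let ?l = "\<lambda>e. if x e > 0 then 1 else -1 :: int" and ?u = "\<lambda>e. if x e < 0 then -1 else 1 :: int"
  have "\<exists>c. int_cycle G c \<and> (\<forall>e\<in>arcs G. ?l e \<le> c e \<and> c e \<le> ?u e)"
  proof (rule hoffman_circulation)
    fix U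
    \<comment> \<open>Raising f by one on U changes the norm of w - df by the negated cut sum.\<close>
    have "N (\<lambda>v. f v + of_bool (v \<in> U)) - N f =
      (\<Sum>e\<in>arcs G. - (if head G e \<in> U \<and> tail G e \<notin> U then ?l e
                   else if tail G e \<in> U \<and> head G e \<notin> U then - ?u e else 0))"
      unfolding N_def sum_subtractf[symmetric] x_def by (rule sum.cong) auto
    then show "(\<Sum>e\<in>arcs G. if head G e \<in> U \<and> tail G e \<notin> U then ?l e
                   else if tail G e \<in> U \<and> head G e \<notin> U then - ?u e else 0) \<le> 0"
      using fmin[of "\<lambda>v. f v + of_bool (v \<in> U)"] by (simp only: sum_negf)
  qed auto
  then obtain c where c: "int_cycle G c" "\<And>e. e \<in> arcs G \<Longrightarrow> ?l e \<le> c e \<and> c e \<le> ?u e" by blast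
  have "pairing G c w = pairing G c (\<lambda>e. x e + (f (head G e) - f (tail G e)))"
    by (simp add: x_def)
  also have "\<dots> = pairing G c x"
    by (simp only: pairing_add_right pairing_coboundary[OF c(1)] add_0_right)
  also have "\<dots> = N f"
    unfolding pairing_def N_def x_def[symmetric]
  proof (rule sum.cong)
    fix e assume "e \<in> arcs G"
    then have "x e = 0 \<or> x e > 0 \<and> c e = 1 \<or> x e < 0 \<and> c e = -1"
      using c(2)[of e] by (cases "x e" "0::int" rule: linorder_cases) auto
    then show "of_int (c e) * x e = \<bar>x e\<bar>" by auto
  qed simp
  finally have "pairing G c w = N f" .
  moreover have "c e = 0 \<or> c e = 1 \<or> c e = -1" if "e \<in> arcs G" for e
    using c(2)[OF that] by (auto split: if_splits)
  ultimately show ?thesis using c(1) unfolding N_def by blast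
qed

section \<open>Flows along walks, cycles through an arc, and potentials\<close>

lemma connected_imp_flow:
  assumes "A \<subseteq> arcs G"
    and "(s, t) \<in> {(u, w). \<exists>a\<in>A. (tail G a = u \<and> head G a = w) \<or> (tail G a = w \<and> head G a = u)}\<^sup>*"
  shows "\<exists>c. (\<forall>v. bd G c v = of_bool (v = t) - of_bool (v = s)) \<and> (\<forall>e. e \<notin> A \<longrightarrow> c e = 0)"
  using assms(2)
proof (induction rule: rtrancl_induct)
  case base
  show ?case by (rule exI[of _ "\<lambda>_. 0"]) (simp add: bd_def)
next
  case (step y z)
  obtain c where c: "\<And>v. bd G c v = of_bool (v = y) - of_bool (v = s)" "\<And>e. e \<notin> A \<Longrightarrow> c e = 0"
    using step.IH by blast
  obtain a k where a: "a \<in> A"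
    and ends: "tail G a = y \<and> head G a = z \<and> k = 1 \<or> head G a = y \<and> tail G a = z \<and> k = (-1::int)"
    using step.hyps(2) by blast
  have "a \<in> arcs G" using a assms(1) by blast
  show ?case
    by (rule exI[of _ "\<lambda>e. c e + k * of_bool (e = a)"])
      (use ends c a in \<open>auto simp: bd_add bd_single[OF \<open>a \<in> arcs G\<close>]\<close>)
qed

text \<open>The endpoints of \<open>a\<close> stay connected without \<open>a\<close>; close up
  \<open>a\<close> with a unit flow that avoids it.\<close>

lemma cycle_through_nonbridge:
  assumes "a \<in> arcs G" "\<not> is_bridge G a"
  shows "\<exists>z. int_cycle G z \<and> z a = 1"
proof -
  have "(tail G a, head G a) \<in> {(u, w). \<exists>b\<in>arcs G - {a}.
     (tail G b = u \<and> head G b = w) \<or> (tail G b = w \<and> head G b = u)}\<^sup>*"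
    using assms by (simp add: is_bridge_def undir_adj_def pre_digraph.del_arc_def)
  from connected_imp_flow[OF _ this] obtain c where
    c: "\<And>v. bd G c v = of_bool (v = head G a) - of_bool (v = tail G a)" "c a = 0"
    by auto
  show ?thesis
    by (rule exI[of _ "\<lambda>e. of_bool (e = a) - c e"])
      (use c bd_single[OF assms(1), of 1] in \<open>auto simp: int_cycle_def bd_diff\<close>)
qed

text \<open>Integrate \<open>w\<close> along a flow from a root of the component to each vertex. The
  error at an arc is the pairing of \<open>w\<close> with the cycle made of that arc and the two
  root flows. With \<open>H\<close> = {0} this yields a coboundary; with \<open>H\<close> the even
  integers, a coboundary modulo 2.\<close>

lemma coboundary_modulo:
  fixes w :: "'b \<Rightarrow> 'r::comm_ring_1"
  assumes "\<And>z. int_cycle G z \<Longrightarrow> pairing G z w \<in> H"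
  shows "\<exists>f. \<forall>e\<in>arcs G. w e - (f (head G e) - f (tail G e)) \<in> H"
proof -
  let ?R = "(undir_adj G)\<^sup>*"
  have "sym (undir_adj G)" by (auto simp: undir_adj_def sym_def)
  then have sym: "sym ?R" by (rule sym_rtrancl)
  \<comment> \<open>The choice depends only on the component of \<open>v\<close>, so the two ends of
    an arc get the same root.\<close>
  define r where "r v = (SOME x. (x, v) \<in> ?R)" for v
  have r: "(r v, v) \<in> ?R" for v unfolding r_def by (rule someI[of _ v]) simp
  have "\<exists>c. \<forall>x. bd G c x = of_bool (x = v) - of_bool (x = r v)" for v
    using connected_imp_flow[of "arcs G" "r v" v] r[of v] unfolding undir_adj_def by blast
  then obtain p where p: "\<And>v x. bd G (p v) x = of_bool (x = v) - of_bool (x = r v)"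
    by metis
  define f where "f v = pairing G (p v) w" for v
  have "w e - (f (head G e) - f (tail G e)) \<in> H" if e: "e \<in> arcs G" for e
  proof -
    have "(tail G e, head G e) \<in> undir_adj G" using e by (auto simp: undir_adj_def)
    then have "(x, tail G e) \<in> ?R \<longleftrightarrow> (x, head G e) \<in> ?R" for x
      using sym by (meson r_into_rtrancl rtrancl_trans symD)
    then have "r (tail G e) = r (head G e)" by (simp add: r_def)
    then have "int_cycle G (\<lambda>b. of_bool (b = e) - (p (head G e) b - p (tail G e) b))"
      using bd_single[OF e, of 1] by (auto simp: int_cycle_def bd_diff p)
    from assms[OF this] show ?thesis
      by (simp add: pairing_diff pairing_single[OF e] f_def)
  qed
  then show ?thesis by blast
qed

end

section \<open>The averaged form\<close>

definition parity :: "('v,'e) pre_digraph \<Rightarrow> ('e \<Rightarrow> int) \<Rightarrow> 'e set" where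
  "parity G z = {e \<in> arcs G. odd (z e)}"

text \<open>This is the cycle space over the field of two elements, because reduction of integral
  cycles modulo 2 is onto. Taking it as an image supplies an integral cycle for each member.\<close>

definition even_subgraphs :: "('v,'e) pre_digraph \<Rightarrow> 'e set set" where
  "even_subgraphs G = parity G ` Collect (int_cycle G)"

text \<open>The conditions range over the whole type, so \<open>c\<close> vanishes off
  \<open>D\<close> and the set is finite for finite \<open>D\<close>.\<close>

definition eulerian_orientations :: "('v,'e) pre_digraph \<Rightarrow> 'e set \<Rightarrow> ('e \<Rightarrow> int) set" where
  "eulerian_orientations G D = {c. int_cycle G c \<and> (\<forall>e. c e = 0 \<or> c e = 1 \<or> c e = -1) \<and>
     (\<forall>e. odd (c e) \<longleftrightarrow> e \<in> D)}"

definition mean_square :: "('v,'e) pre_digraph \<Rightarrow> 'e set \<Rightarrow> ('e \<Rightarrow> real) \<Rightarrow> real" where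
  "mean_square G D x = (\<Sum>c\<in>eulerian_orientations G D. (pairing G c x)\<^sup>2)
     / card (eulerian_orientations G D)"

text \<open>A positive combination of the squares of the cycles \<open>c\<close>. The factor 2
  compensates for the fact that a class nonzero modulo 2 is odd on only half of the even
  subgraphs.\<close>

definition emm :: "('v,'e) pre_digraph \<Rightarrow> 'e \<Rightarrow> 'e \<Rightarrow> rat" where
  "emm G e e' = (\<Sum>D\<in>even_subgraphs G. \<Sum>c\<in>eulerian_orientations G D.
     2 / (of_nat (card (even_subgraphs G)) * of_nat (card (eulerian_orientations G D)))
       * of_int (c e * c e'))"

lemma sum_rotate3:
  "(\<Sum>e\<in>A. \<Sum>f\<in>B. \<Sum>d\<in>C. g e f d) = (\<Sum>d\<in>C. \<Sum>e\<in>A. \<Sum>f\<in>B. g e f d)"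
  by (simp only: sum.swap[of _ C])

lemma qform_emm:
  "qform G (emm G) x = 2 / card (even_subgraphs G) * (\<Sum>D\<in>even_subgraphs G. mean_square G D x)"
proof -
  define a :: "'b set \<Rightarrow> real" where
    "a D = 2 / (card (even_subgraphs G) * card (eulerian_orientations G D))" for D
  have "qform G (emm G) x = (\<Sum>e\<in>arcs G. \<Sum>e'\<in>arcs G. \<Sum>D\<in>even_subgraphs G.
      \<Sum>c\<in>eulerian_orientations G D. a D * ((of_int (c e) * x e) * (of_int (c e') * x e')))"
    unfolding qform_def emm_def a_def
    by (simp add: of_rat_sum of_rat_mult of_rat_divide sum_distrib_right sum_distrib_left mult_ac)
  also have "\<dots> = (\<Sum>D\<in>even_subgraphs G. \<Sum>c\<in>eulerian_orientations G D.
      \<Sum>e\<in>arcs G. \<Sum>e'\<in>arcs G. a D * ((of_int (c e) * x e) * (of_int (c e') * x e')))"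
    unfolding sum_rotate3[where C = "even_subgraphs G"]
    by (rule sum.cong[OF refl], rule sum_rotate3)
  also have "\<dots> = (\<Sum>D\<in>even_subgraphs G. \<Sum>c\<in>eulerian_orientations G D. a D * (pairing G c x)\<^sup>2)"
    by (simp add: pairing_def power2_eq_square sum_product flip: sum_distrib_left)
  also have "\<dots> = 2 / card (even_subgraphs G) * (\<Sum>D\<in>even_subgraphs G. mean_square G D x)"
    by (simp add: a_def mean_square_def sum_distrib_left sum_divide_distrib)
  finally show ?thesis .
qed

lemma qform_emm_nonneg: "qform G (emm G) x \<ge> 0"
  unfolding qform_emm by (auto simp: mean_square_def intro!: mult_nonneg_nonneg sum_nonneg divide_nonneg_nonneg)

section \<open>Finiteness of the averages and membership in the symmetric square\<close>

context fin_digraph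
begin

lemma finite_even_subgraphs: "finite (even_subgraphs G)"
  by (rule finite_subset[of _ "Pow (arcs G)"]) (auto simp: even_subgraphs_def parity_def)

lemma even_subgraph_subset: "D \<in> even_subgraphs G \<Longrightarrow> D \<subseteq> arcs G"
  by (auto simp: even_subgraphs_def parity_def)

lemma card_even_subgraphs_pos: "card (even_subgraphs G) > 0"
proof -
  have "int_cycle G (\<lambda>_. 0)" by (simp add: int_cycle_def bd_def)
  then show ?thesis using finite_even_subgraphs by (auto simp: card_gt_0_iff even_subgraphs_def)
qed

lemma finite_eulerian_orientations:
  assumes "D \<in> even_subgraphs G"
  shows "finite (eulerian_orientations G D)"
proof (rule finite_subset)
  show "eulerian_orientations G D \<subseteq>
      {c. \<forall>e. (e \<in> arcs G \<longrightarrow> c e \<in> {0, 1, -1}) \<and> (e \<notin> arcs G \<longrightarrow> c e = 0)}"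
    using even_subgraph_subset[OF assms] by (fastforce simp: eulerian_orientations_def)
  show "finite {c. \<forall>e. (e \<in> arcs G \<longrightarrow> c e \<in> {0, 1, -1::int}) \<and> (e \<notin> arcs G \<longrightarrow> c e = 0)}"
    by (rule finite_set_of_finite_funs) auto
qed

text \<open>An integral cycle with odd support \<open>D\<close> reduces to an orientation of
  \<open>D\<close>. This makes \<open>mean_square\<close> a genuine average.\<close>

lemma card_eulerian_orientations_pos:
  assumes "D \<in> even_subgraphs G"
  shows "card (eulerian_orientations G D) > 0"
proof -
  obtain z where "int_cycle G z" "D = parity G z" using assms by (auto simp: even_subgraphs_def)
  then have "eulerian_orientations G D \<noteq> {}"
    using unit_cycle_of_parity[of z] by (auto simp: eulerian_orientations_def parity_def)
  then show ?thesis using finite_eulerian_orientations[OF assms] by (simp add: card_gt_0_iff)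
qed

text \<open>Each column is a rational combination of the cycles \<open>c\<close>, with coefficients
  proportional to \<open>c e'\<close>, so its boundary vanishes.\<close>

lemma in_Sym2_H1_emm: "in_Sym2_H1 G (emm G)"
  unfolding in_Sym2_H1_def
proof (intro conjI allI ballI impI)
  show "emm G e e' = emm G e' e" for e e' by (simp add: emm_def mult.commute)
  show "emm G e e' = 0" if "e \<notin> arcs G \<or> e' \<notin> arcs G" for e e'
    unfolding emm_def
  proof (intro sum.neutral ballI)
    fix D c assume "D \<in> even_subgraphs G" "c \<in> eulerian_orientations G D"
    then have "c e = 0 \<or> c e' = 0"
      using that even_subgraph_subset[of D] unfolding eulerian_orientations_def by fastforce
    then show "2 / (of_nat (card (even_subgraphs G)) * of_nat (card (eulerian_orientations G D)))
       * rat_of_int (c e * c e') = 0" by auto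
  qed
  show "is_cycle_rat G (\<lambda>e. emm G e e')" for e'
    unfolding is_cycle_rat_def
  proof
    fix v
    define s where "s e = (of_bool (head G e = v) - of_bool (tail G e = v) :: int)" for e
    have "(\<Sum>e\<in>{e\<in>arcs G. head G e = v}. emm G e e') - (\<Sum>e\<in>{e\<in>arcs G. tail G e = v}. emm G e e')
      = (\<Sum>e\<in>arcs G. emm G e e' * of_int (s e))"
      unfolding sum.inter_filter[OF finite_arcs] sum_subtractf[symmetric]
      by (rule sum.cong) (auto simp: s_def)
    also have "\<dots> = (\<Sum>D\<in>even_subgraphs G. \<Sum>c\<in>eulerian_orientations G D.
        \<Sum>e\<in>arcs G. 2 / (of_nat (card (even_subgraphs G)) * of_nat (card (eulerian_orientations G D)))
       * of_int (c e * c e') * of_int (s e))"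
      unfolding emm_def sum_distrib_right
      by (subst sum.swap) (intro sum.cong[OF refl], rule sum.swap)
    also have "\<dots> = (\<Sum>D\<in>even_subgraphs G. \<Sum>c\<in>eulerian_orientations G D.
        2 / (of_nat (card (even_subgraphs G)) * of_nat (card (eulerian_orientations G D)))
       * of_int (c e') * of_int (bd G c v))"
      by (simp add: bd_def s_def sum_distrib_left mult_ac)
    also have "\<dots> = 0"
      by (intro sum.neutral ballI) (simp add: eulerian_orientations_def int_cycle_def)
    finally show "(\<Sum>e\<in>{e\<in>arcs G. head G e = v}. emm G e e')
        - (\<Sum>e\<in>{e\<in>arcs G. tail G e = v}. emm G e e') = 0" .
  qed
qed

section \<open>Counting parities\<close>

lemma odd_pairing_iff: "odd (pairing G z w) \<longleftrightarrow> odd (\<Sum>e\<in>parity G z. w e)" for w :: "'b \<Rightarrow> int"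
proof -
  have "even (pairing G z w - (\<Sum>e\<in>parity G z. w e))"
    unfolding pairing_def parity_def sum.inter_filter[OF finite_arcs] sum_subtractf[symmetric]
    by (rule dvd_sum) auto
  then show ?thesis by simp
qed

lemma eulerian_orientation_parity: "c \<in> eulerian_orientations G D \<Longrightarrow> D \<in> even_subgraphs G \<Longrightarrow> parity G c = D"
  using even_subgraph_subset by (auto simp: eulerian_orientations_def parity_def)

text \<open>Adding the odd support of \<open>z0\<close> modulo 2 is an involution of the even
  subgraphs that exchanges odd and even values of \<open>w\<close>.\<close>

lemma card_odd_even_subgraphs:
  fixes w :: "'b \<Rightarrow> int"
  assumes z0: "int_cycle G z0" and odd0: "odd (pairing G z0 w)"
  shows "2 * card {D \<in> even_subgraphs G. odd (\<Sum>e\<in>D. w e)} = card (even_subgraphs G)"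
proof -
  let ?K = "even_subgraphs G"
  let ?O = "{D \<in> ?K. odd (\<Sum>e\<in>D. w e)}" and ?E = "{D \<in> ?K. even (\<Sum>e\<in>D. w e)}"
  define h where "h D = sym_diff D (parity G z0)" for D
  have h_parity: "h (parity G z) = parity G (\<lambda>e. z e + z0 e)" for z
    by (auto simp: h_def parity_def)
  have h: "h D \<in> ?K \<and> (odd (\<Sum>e\<in>h D. w e) \<longleftrightarrow> even (\<Sum>e\<in>D. w e))" if D: "D \<in> ?K" for D
  proof -
    obtain z where z: "int_cycle G z" "D = parity G z" using D by (auto simp: even_subgraphs_def)
    have "odd (\<Sum>e\<in>h D. w e) \<longleftrightarrow> odd (pairing G (\<lambda>e. z e + z0 e) w)"
      by (simp add: z h_parity odd_pairing_iff)
    moreover have "odd (\<Sum>e\<in>D. w e) \<longleftrightarrow> odd (pairing G z w)" by (simp add: z odd_pairing_iff)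
    ultimately show ?thesis
      using odd0 int_cycle_add[OF z(1) z0] by (auto simp: pairing_add z h_parity even_subgraphs_def)
  qed
  have hh: "h (h D) = D" for D by (auto simp: h_def)
  have "bij_betw h ?O ?E" by (rule bij_betw_byWitness[of _ h]) (use h hh in auto)
  then have "card ?O = card ?E" by (rule bij_betw_same_card)
  moreover have "?K = ?O \<union> ?E" "?O \<inter> ?E = {}" by auto
  ultimately show ?thesis
    using card_Un_disjoint[of ?O ?E] finite_even_subgraphs by auto
qed

section \<open>Positive definiteness\<close>

lemma qform_emm_eq_pairing:
  assumes "\<And>c. int_cycle G c \<Longrightarrow> (pairing G c x)\<^sup>2 = k * (pairing G c y)\<^sup>2"
  shows "qform G (emm G) x = k * qform G (emm G) y"
proof -
  have "mean_square G D x = k * mean_square G D y" for D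
    using assms by (simp add: mean_square_def eulerian_orientations_def sum_distrib_left)
  then show ?thesis unfolding qform_emm by (simp flip: sum_distrib_left)
qed

text \<open>If the form vanishes at \<open>x\<close>, then so does the pairing of \<open>x\<close>
  with every cycle with values in {-1, 0, 1}. These generate all integral cycles: write z = c + 2y
  with \<open>c\<close> such a cycle of the same parity and recurse on \<open>y\<close>. Hence
  \<open>x\<close> is a coboundary.\<close>

lemma qform_emm_pos:
  fixes x :: "'b \<Rightarrow> real"
  assumes "\<not> real_coboundary G x"
  shows "qform G (emm G) x > 0"
proof (rule ccontr)
  let ?K = "even_subgraphs G"
  assume "\<not> ?thesis"
  then have "qform G (emm G) x = 0" using qform_emm_nonneg[of G x] by linarith
  then have "(\<Sum>D\<in>?K. mean_square G D x) = 0"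
    using card_even_subgraphs_pos by (simp add: qform_emm)
  then have ms: "mean_square G D x = 0" if "D \<in> ?K" for D
    using that sum_nonneg_eq_0_iff[OF finite_even_subgraphs, of "\<lambda>D. mean_square G D x"]
    by (simp add: mean_square_def sum_nonneg)
  have unit0: "pairing G c x = 0" if "c \<in> eulerian_orientations G D" "D \<in> ?K" for c D
    using ms[OF that(2)] card_eulerian_orientations_pos[OF that(2)] that(1)
      sum_nonneg_eq_0_iff[OF finite_eulerian_orientations[OF that(2)], of "\<lambda>c. (pairing G c x)\<^sup>2"]
    by (simp add: mean_square_def)
  have "pairing G z x = 0" if "int_cycle G z" for z using that
  proof (induction "nat (\<Sum>e\<in>arcs G. \<bar>z e\<bar>)" arbitrary: z rule: less_induct)
    case less
    obtain c where c: "int_cycle G c" "\<And>e. c e = 0 \<or> c e = 1 \<or> c e = -1"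
      "\<And>e. odd (c e) \<longleftrightarrow> e \<in> arcs G \<and> odd (z e)"
      using unit_cycle_of_parity[OF less.prems] by blast
    define y where "y e = (z e - c e) div 2" for e
    have yz: "z e = c e + 2 * y e" if "e \<in> arcs G" for e
      using c(3)[of e] that by (simp add: y_def)
    have "c \<in> eulerian_orientations G (parity G z)" "parity G z \<in> ?K"
      using c less.prems by (auto simp: eulerian_orientations_def parity_def even_subgraphs_def)
    then have pc: "pairing G c x = 0" by (rule unit0)
    have "bd G z v = bd G c v + 2 * bd G y v" for v
      unfolding bd_scale[symmetric] bd_add[symmetric] unfolding bd_def
      by (rule sum.cong) (simp_all add: yz)
    then have y: "int_cycle G y" using c(1) less.prems by (simp add: int_cycle_def)
    have pz: "pairing G z x = pairing G c x + 2 * pairing G y x"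
      unfolding pairing_def sum_distrib_left sum.distrib[symmetric]
      by (rule sum.cong) (simp_all add: yz algebra_simps)
    show ?case
    \<comment> \<open>If all \<bar>z e\<bar> are at most 1, \<open>y\<close> need not be smaller (c
      = -z gives y = z), but then \<open>z\<close> is already a unit cycle.\<close>
    proof (cases "\<exists>e\<in>arcs G. \<bar>z e\<bar> \<ge> 2")
      case True
      have le: "\<bar>y e\<bar> \<le> \<bar>z e\<bar> \<and> (\<bar>z e\<bar> \<ge> 2 \<longrightarrow> \<bar>y e\<bar> < \<bar>z e\<bar>)" if "e \<in> arcs G" for e
        using yz[OF that] c(2)[of e] by presburger
      have "(\<Sum>e\<in>arcs G. \<bar>y e\<bar>) < (\<Sum>e\<in>arcs G. \<bar>z e\<bar>)"
        by (rule sum_strict_mono_ex1) (use le True in auto)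
      then have "nat (\<Sum>e\<in>arcs G. \<bar>y e\<bar>) < nat (\<Sum>e\<in>arcs G. \<bar>z e\<bar>)"
        using sum_nonneg[of "arcs G" "\<lambda>e. \<bar>y e\<bar>"] by linarith
      from less.hyps[OF this y] pc pz show ?thesis by simp
    next
      case False
      \<comment> \<open>Values off the arcs are cleared, since an orientation must vanish
        there.\<close>
      define z' where "z' e = (if e \<in> arcs G then z e else 0)" for e
      have "bd G z' v = bd G z v" for v
        unfolding bd_def z'_def by (rule sum.cong) auto
      moreover have "z' e = 0 \<or> z' e = 1 \<or> z' e = -1" for e
      proof -
        have "\<bar>z' e\<bar> < 2" using False by (auto simp: z'_def)
        then show ?thesis by linarith
      qed
      ultimately have "z' \<in> eulerian_orientations G (parity G z)"
        using less.prems by (auto simp: eulerian_orientations_def int_cycle_def parity_def z'_def)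
      from unit0[OF this \<open>parity G z \<in> ?K\<close>] have "pairing G z' x = 0" .
      moreover have "pairing G z' x = pairing G z x"
        unfolding pairing_def z'_def by (rule sum.cong) auto
      ultimately show ?thesis by simp
    qed
  qed
  then have "\<exists>f. \<forall>e\<in>arcs G. x e - (f (head G e) - f (tail G e)) \<in> {0}"
    by (intro coboundary_modulo) simp
  then show False using assms by (auto simp: real_coboundary_def)
qed

section \<open>Lower bounds on integral classes\<close>

text \<open>On every \<open>D\<close> where \<open>w\<close> is odd, each orientation pairs with
  \<open>w\<close> to an odd integer, of square at least 1. Half of the even subgraphs are of this
  kind, which gives total weight 1. Equality forces every single square to equal its lower
  bound.\<close>

lemma qform_emm_odd:
  fixes w :: "'b \<Rightarrow> int"
  assumes z0: "int_cycle G z0" "odd (pairing G z0 w)"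
  defines "q \<equiv> qform G (emm G) (\<lambda>e. real_of_int (w e))"
  shows "q \<ge> 1"
    and "q = 1 \<Longrightarrow> D \<in> even_subgraphs G \<Longrightarrow> c \<in> eulerian_orientations G D \<Longrightarrow>
           (pairing G c w)\<^sup>2 = of_bool (odd (\<Sum>e\<in>D. w e))"
proof -
  let ?K = "even_subgraphs G" and ?C = "eulerian_orientations G"
  let ?w = "\<lambda>e. real_of_int (w e)"
  define b :: "'b set \<Rightarrow> int" where "b D = of_bool (odd (\<Sum>e\<in>D. w e))" for D
  have sq: "(pairing G c w)\<^sup>2 \<ge> b D" if "D \<in> ?K" "c \<in> ?C D" for c D
  proof (cases "odd (\<Sum>e\<in>D. w e)")
    case True
    then have "pairing G c w \<noteq> 0"
      using odd_pairing_iff[of c w] eulerian_orientation_parity[OF that(2,1)] by auto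
    then have "(pairing G c w)\<^sup>2 > 0" by simp
    then have "(pairing G c w)\<^sup>2 \<ge> 1" by linarith
    then show ?thesis by (simp add: b_def)
  qed (simp add: b_def)
  have ms: "mean_square G D ?w - b D = (\<Sum>c\<in>?C D. real_of_int ((pairing G c w)\<^sup>2 - b D)) / card (?C D)"
    if "D \<in> ?K" for D
    using card_eulerian_orientations_pos[OF that]
    by (simp add: mean_square_def pairing_of_int sum_subtractf field_simps)
  have ms_ge: "mean_square G D ?w - b D \<ge> 0" if "D \<in> ?K" for D
    unfolding ms[OF that] using sq[OF that]
    by (intro divide_nonneg_nonneg sum_nonneg) (simp_all del: of_int_diff of_int_power)
  have "(\<Sum>D\<in>?K. real_of_int (b D)) = card {D \<in> ?K. odd (\<Sum>e\<in>D. w e)}"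
    using finite_even_subgraphs by (simp add: b_def Int_def)
  then have "2 * (\<Sum>D\<in>?K. real_of_int (b D)) = card ?K"
    using card_odd_even_subgraphs[OF z0] by linarith
  \<comment> \<open>The excess over 1 is a positive multiple of a sum of nonnegative defects, so
    both claims can be read off from it.\<close>
  then have q: "q - 1 = 2 / card ?K * (\<Sum>D\<in>?K. mean_square G D ?w - b D)"
    using card_even_subgraphs_pos unfolding q_def qform_emm sum_subtractf by (simp add: field_simps)
  show "q \<ge> 1"
  proof -
    have "q - 1 \<ge> 0" unfolding q using ms_ge by (intro mult_nonneg_nonneg sum_nonneg) auto
    then show ?thesis by simp
  qed
  show "(pairing G c w)\<^sup>2 = of_bool (odd (\<Sum>e\<in>D. w e))"
    if q1: "q = 1" and D: "D \<in> ?K" and c: "c \<in> ?C D"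
  proof -
    have "(\<Sum>D\<in>?K. mean_square G D ?w - b D) = 0" using q q1 card_even_subgraphs_pos by simp
    then have "mean_square G D ?w - b D = 0"
      using sum_nonneg_eq_0_iff[OF finite_even_subgraphs, of "\<lambda>D. mean_square G D ?w - b D"] ms_ge D
      by blast
    then have "(\<Sum>c\<in>?C D. real_of_int ((pairing G c w)\<^sup>2 - b D)) = 0"
      using ms[OF D] card_eulerian_orientations_pos[OF D] by simp
    then have "real_of_int ((pairing G c w)\<^sup>2 - b D) = 0"
      using sum_nonneg_eq_0_iff[OF finite_eulerian_orientations[OF D],
          of "\<lambda>c. real_of_int ((pairing G c w)\<^sup>2 - b D)"] sq[OF D] c
      by (metis (no_types, lifting) diff_ge_0_iff_ge of_int_0_le_iff)
    then show ?thesis by (simp add: b_def del: of_int_diff of_int_power)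
  qed
qed

text \<open>If \<open>w\<close> pairs evenly with all cycles, then it is 2y up to a coboundary, so
  q(w) = 4 q(y), while the nonzero pairing with the fixed cycle \<open>z\<close> is halved. By
  induction q(y) \<ge> 1. The bound 4 also keeps such classes away from the value 1.\<close>

lemma qform_emm_descent:
  fixes w :: "'b \<Rightarrow> int"
  assumes "int_cycle G z" "pairing G z w \<noteq> 0"
  shows "(\<exists>z0. int_cycle G z0 \<and> odd (pairing G z0 w)) \<or> qform G (emm G) (\<lambda>e. real_of_int (w e)) \<ge> 4"
  using assms(2)
proof (induction "nat \<bar>pairing G z w\<bar>" arbitrary: w rule: less_induct)
  case less
  show ?case
  proof (cases "\<exists>z0. int_cycle G z0 \<and> odd (pairing G z0 w)")
    case False
    then have "\<exists>f. \<forall>e\<in>arcs G. w e - (f (head G e) - f (tail G e)) \<in> {k. even k}"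
      by (intro coboundary_modulo) auto
    then obtain f where f: "\<And>e. e \<in> arcs G \<Longrightarrow> even (w e - (f (head G e) - f (tail G e)))"
      by auto
    define y where "y e = (w e - (f (head G e) - f (tail G e))) div 2" for e
    have wy: "w e = 2 * y e + (f (head G e) - f (tail G e))" if "e \<in> arcs G" for e
      using f[OF that] unfolding y_def by simp
    have pw: "pairing G c w = 2 * pairing G c y" if "int_cycle G c" for c
    proof -
      have "pairing G c w = pairing G c (\<lambda>e. 2 * y e + (f (head G e) - f (tail G e)))"
        unfolding pairing_def by (rule sum.cong) (simp_all add: wy)
      also have "\<dots> = 2 * pairing G c y"
        by (simp only: pairing_add_right pairing_scale_right pairing_coboundary[OF that] add_0_right)
      finally show ?thesis .
    qed
    have "qform G (emm G) (\<lambda>e. real_of_int (w e)) = 4 * qform G (emm G) (\<lambda>e. real_of_int (y e))"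
      by (rule qform_emm_eq_pairing) (simp add: pairing_of_int pw power_mult_distrib)
    moreover have "nat \<bar>pairing G z y\<bar> < nat \<bar>pairing G z w\<bar>" "pairing G z y \<noteq> 0"
      using less.prems pw[OF assms(1)] by auto
    then have "qform G (emm G) (\<lambda>e. real_of_int (y e)) \<ge> 1"
      using less.hyps[of y] qform_emm_odd(1)[of _ y] by fastforce
    ultimately show ?thesis by simp
  qed blast
qed

text \<open>A cochain that pairs to zero with all integral cycles is an integral coboundary, so
  descent can start from some cycle.\<close>

lemma qform_emm_int:
  fixes w :: "'b \<Rightarrow> int"
  assumes "\<not> int_coboundary G w"
  shows "(\<exists>z0. int_cycle G z0 \<and> odd (pairing G z0 w)) \<or> qform G (emm G) (\<lambda>e. real_of_int (w e)) \<ge> 4"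
proof -
  have "\<exists>z. int_cycle G z \<and> pairing G z w \<noteq> 0"
  proof (rule ccontr)
    assume "\<not> ?thesis"
    then have "\<exists>f. \<forall>e\<in>arcs G. w e - (f (head G e) - f (tail G e)) \<in> {0}"
      by (intro coboundary_modulo) auto
    then show False using assms by (auto simp: int_coboundary_def)
  qed
  then show ?thesis using qform_emm_descent by blast
qed

lemma qform_emm_coboundary:
  assumes "int_coboundary G w"
  shows "qform G (emm G) (\<lambda>e. real_of_int (w e)) = 0"
proof -
  obtain f where f: "\<And>e. e \<in> arcs G \<Longrightarrow> w e = f (head G e) - f (tail G e)"
    using assms by (auto simp: int_coboundary_def)
  have "pairing G c w = 0" if "int_cycle G c" for c
  proof -
    have "pairing G c w = pairing G c (\<lambda>e. f (head G e) - f (tail G e))"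
      unfolding pairing_def by (rule sum.cong) (simp_all add: f)
    then show ?thesis by (simp add: pairing_coboundary[OF that])
  qed
  \<comment> \<open>The comparison of forms is applied with factor 0, \<open>w\<close> itself
    serving as the second argument.\<close>
  then have "qform G (emm G) (\<lambda>e. real_of_int (w e)) = 0 * qform G (emm G) (\<lambda>e. real_of_int (w e))"
    by (intro qform_emm_eq_pairing) (simp add: pairing_of_int)
  then show ?thesis by simp
qed

section \<open>Classes of value 1\<close>

text \<open>An orientation \<open>c\<close> of \<open>D\<close> pairs with the coedge to
  \<open>c a\<close>, which is 1 or -1 if \<open>a\<close> lies in \<open>D\<close> and 0 otherwise.
  A cycle through \<open>a\<close> shows that half of the even subgraphs contain
  \<open>a\<close>.\<close>

lemma qform_emm_coedge:
  assumes a: "a \<in> arcs G" "\<not> is_bridge G a"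
  shows "qform G (emm G) (\<lambda>e. real_of_int (coedge a e)) = 1"
proof -
  let ?K = "even_subgraphs G" and ?C = "eulerian_orientations G"
  obtain z where z: "int_cycle G z" "z a = 1" using cycle_through_nonbridge[OF a] by blast
  have sum_coedge: "odd (\<Sum>e\<in>D. coedge a e) \<longleftrightarrow> a \<in> D" if "D \<in> ?K" for D
    using finite_subset[OF even_subgraph_subset[OF that] finite_arcs] by (simp add: coedge_def)
  have "mean_square G D (\<lambda>e. real_of_int (coedge a e)) = of_bool (a \<in> D)" if D: "D \<in> ?K" for D
  proof -
    have "(pairing G c (\<lambda>e. real_of_int (coedge a e)))\<^sup>2 = of_bool (a \<in> D)" if c: "c \<in> ?C D" for c
    proof -
      have "odd (c a) \<longleftrightarrow> a \<in> D" "c a = 0 \<or> c a = 1 \<or> c a = -1"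
        using c by (auto simp: eulerian_orientations_def)
      then show ?thesis by (auto simp: pairing_of_int pairing_coedge[OF a(1)])
    qed
    then show ?thesis using card_eulerian_orientations_pos[OF D] by (simp add: mean_square_def)
  qed
  then have "(\<Sum>D\<in>?K. mean_square G D (\<lambda>e. real_of_int (coedge a e))) = card {D \<in> ?K. a \<in> D}"
    using finite_even_subgraphs by (simp add: Int_def)
  also have "{D \<in> ?K. a \<in> D} = {D \<in> ?K. odd (\<Sum>e\<in>D. coedge a e)}"
    using sum_coedge by auto
  finally have "2 * (\<Sum>D\<in>?K. mean_square G D (\<lambda>e. real_of_int (coedge a e))) = card ?K"
    using card_odd_even_subgraphs[OF z(1), of "coedge a"] z(2) by (simp add: pairing_coedge[OF a(1)])
  then show ?thesis using card_even_subgraphs_pos by (simp add: qform_emm field_simps)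
qed

text \<open>In the equality case \<open>w\<close> pairs with every unit cycle to at most 1 in
  absolute value. By duality one such pairing equals the l1 norm of an integral representative; that
  representative is nonzero, so it is a single coedge up to sign.\<close>

lemma qform_emm_eq_1:
  fixes w :: "'b \<Rightarrow> int"
  assumes q1: "qform G (emm G) (\<lambda>e. real_of_int (w e)) = 1"
  shows "\<exists>a\<in>arcs G. H1_int_eq G w (coedge a) \<or> H1_int_eq G w (\<lambda>e. - coedge a e)"
proof -
  \<comment> \<open>A coboundary has value 0, and a nonzero class without odd pairings has value at
    least 4.\<close>
  have ncob: "\<not> int_coboundary G w" using q1 qform_emm_coboundary by fastforce
  then obtain z0 where z0: "int_cycle G z0" "odd (pairing G z0 w)"
    using qform_emm_int q1 by fastforce
  obtain c f where c: "int_cycle G c" "\<And>e. e \<in> arcs G \<Longrightarrow> c e = 0 \<or> c e = 1 \<or> c e = -1"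
    and cf: "pairing G c w = (\<Sum>e\<in>arcs G. \<bar>w e - (f (head G e) - f (tail G e))\<bar>)"
    using unit_cycle_duality[of w] by blast
  define x where "x e = w e - (f (head G e) - f (tail G e))" for e
  define c' where "c' e = (if e \<in> arcs G then c e else 0)" for e
  have "bd G c' v = bd G c v" for v unfolding bd_def c'_def by (rule sum.cong) auto
  then have "c' \<in> eulerian_orientations G (parity G c)"
    using c by (auto simp: eulerian_orientations_def int_cycle_def parity_def c'_def)
  moreover have "parity G c \<in> even_subgraphs G" using c(1) by (auto simp: even_subgraphs_def)
  ultimately have "(pairing G c' w)\<^sup>2 \<le> 1" using qform_emm_odd(2)[OF z0 q1] by simp
  moreover have "pairing G c' w = pairing G c w"
    unfolding pairing_def c'_def by (rule sum.cong) auto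
  ultimately have le1: "(\<Sum>e\<in>arcs G. \<bar>x e\<bar>) \<le> 1"
    unfolding cf x_def by (simp add: abs_square_le_1)
  obtain a where a: "a \<in> arcs G" "x a \<noteq> 0"
    using ncob unfolding int_coboundary_def x_def by (metis diff_eq_eq add_0)
  have split: "(\<Sum>e\<in>arcs G. \<bar>x e\<bar>) = \<bar>x a\<bar> + (\<Sum>e\<in>arcs G - {a}. \<bar>x e\<bar>)"
    using a(1) by (simp add: sum.remove)
  have "(\<Sum>e\<in>arcs G - {a}. \<bar>x e\<bar>) \<ge> 0" by (simp add: sum_nonneg)
  \<comment> \<open>The integer \<bar>x a\<bar> is at least 1 and uses up the whole norm.\<close>
  with split le1 a(2) have "\<bar>x a\<bar> = 1" "(\<Sum>e\<in>arcs G - {a}. \<bar>x e\<bar>) = 0" by linarith+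
  then have "x e = 0" if "e \<in> arcs G" "e \<noteq> a" for e
    using that by (simp add: sum_nonneg_eq_0_iff)
  with \<open>\<bar>x a\<bar> = 1\<close> have "(\<forall>e\<in>arcs G. x e = coedge a e) \<or> (\<forall>e\<in>arcs G. x e = - coedge a e)"
    by (auto simp: coedge_def abs_if split: if_splits)
  moreover have "H1_int_eq G w y" if "\<forall>e\<in>arcs G. x e = y e" for y
    using that unfolding H1_int_eq_def int_coboundary_def x_def by (intro exI[of _ f]) auto
  ultimately show ?thesis using a(1) by metis
qed

theorem is_strong_Q_emm_emm: "is_strong_Q_emm G (emm G)"
  unfolding is_strong_Q_emm_def is_Q_emm_def
proof (intro conjI allI ballI impI)
  fix w :: "'b \<Rightarrow> int"
  assume "\<not> int_coboundary G w"
  then show "qform G (emm G) (\<lambda>e. real_of_int (w e)) \<ge> 1"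
    using qform_emm_int[of w] qform_emm_odd(1)[of _ w] by fastforce
qed (use in_Sym2_H1_emm qform_emm_pos qform_emm_coedge qform_emm_eq_1 in auto)

end

theorem theorem5p4:
  fixes G :: "('v,'e) pre_digraph"
  assumes "fin_digraph G" and "cubic G" and "bridgeless G"
  shows "\<exists>M. is_strong_Q_emm G M"
  using fin_digraph.is_strong_Q_emm_emm[OF assms(1)] by blast

end
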